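(* Let $X$ and $Y$ be real smooth normed spaces with $Y$ strictly convex, let $[\cdot,\cdot]$ denote the unique semi-inner product compatible with the norm on each of them, and let $f\colon X\to Y$ be a surjective mapping. The following assertions are equivalent: (i) $|[f(x),f(y)]|=|[x,y]|$ for all $x,y\in X$. (ii) $f$ is phase equivalent to a linear surjective isometry $U\colon X\to Y$. (iii) $\{\|f(x)+f(y)\|,\|f(x)-f(y)\|\}=\{\|x+y\|,\|x-y\|\}$ (equality of sets) for all $x,y\in X$.
   Context: A support functional at $x\in X$ is a linear functional $\phi_x\in X^*$ with $\|\phi_x\|=1$ and $\phi_x(x)=\|x\|$. A normed space is smooth if at each nonzero point there is exactly one support functional. A normed space is strictly convex if its unit sphere contains no non-trivial line segments, i.e. every point of the unit sphere is an extreme point of the closed unit ball. A semi-inner product on a real normed space $X$ compatible with the norm is a function $[\cdot,\cdot]\colon X\times X\to\mathbb{R}$ such that $[x+y,z]=[x,z]+[y,z]$, $[\lambda x,y]=\lambda[x,y]$, $[x,\lambda y]=\lambda[x,y]$ for all $x,y,z\in X$, $\lambda\in\mathbb{R}$; $[x,x]>0$ for $x\neq0$; $|[x,y]|\le[x,x]^{1/2}[y,y]^{1/2}$; and $[x,x]^{1/2}=\|x\|$. If $X$ is smooth, the unique such semi-inner product is $[x,y]=\|y\|\phi_y(x)$ for $y\neq0$ (and $[x,0]=0$). A mapping $f\colon X\to Y$ is phase equivalent to $U\colon X\to Y$ if there is a function $\sigma\colon X\to\mathbb{R}$ with $|\sigma(x)|=1$ and $f(x)=\sigma(x)Ux$ for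 all $x\in X$. A linear $U$ is an isometry if $\|Ux\|=\|x\|$ for all $x\in X$. *)

theory Defs
  imports "HOL-Analysis.Analysis"
begin

definition support_functional :: "'a::real_normed_vector \<Rightarrow> ('a \<Rightarrow>\<^sub>L real) \<Rightarrow> bool" where
  "support_functional x \<phi> \<longleftrightarrow> norm \<phi> = 1 \<and> blinfun_apply \<phi> x = norm x"

definition smooth_space :: "'a::real_normed_vector itself \<Rightarrow> bool" where
  "smooth_space _ \<longleftrightarrow> (\<forall>x::'a. x \<noteq> 0 \<longrightarrow> (\<exists>!\<phi>. support_functional x \<phi>))"

definition strictly_convex_space :: "'a::real_normed_vector itself \<Rightarrow> bool" where
  "strictly_convex_space _ \<longleftrightarrow> (\<forall>x::'a. x \<in> sphere 0 1 \<longrightarrow> x extreme_point_of cball 0 1)"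

definition compatible_sip :: "('a::real_normed_vector \<Rightarrow> 'a \<Rightarrow> real) \<Rightarrow> bool" where
  "compatible_sip s \<longleftrightarrow>
     (\<forall>x y z. s (x + y) z = s x z + s y z) \<and>
     (\<forall>c x y. s (c *\<^sub>R x) y = c * s x y) \<and>
     (\<forall>c x y. s x (c *\<^sub>R y) = c * s x y) \<and>
     (\<forall>x. x \<noteq> 0 \<longrightarrow> s x x > 0) \<and>
     (\<forall>x y. \<bar>s x y\<bar> \<le> sqrt (s x x) * sqrt (s y y)) \<and>
     (\<forall>x. sqrt (s x x) = norm x)"

text \<open>The description below is meaningful on smooth spaces, where the compatible
  semi-inner product exists and is unique; see \<open>smooth_ex1_compatible_sip\<close>.\<close>

definition sip :: "'a::real_normed_vector \<Rightarrow> 'a \<Rightarrow> real" where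
  "sip = (THE s. compatible_sip s)"

definition phase_equivalent ::
    "('a::real_normed_vector \<Rightarrow> 'b::real_normed_vector) \<Rightarrow> ('a \<Rightarrow> 'b) \<Rightarrow> bool" where
  "phase_equivalent f U \<longleftrightarrow>
     (\<exists>\<sigma>::'a \<Rightarrow> real. (\<forall>x. \<bar>\<sigma> x\<bar> = 1) \<and> (\<forall>x. f x = \<sigma> x *\<^sub>R U x))"

definition linear_isometry :: "('a::real_normed_vector \<Rightarrow> 'b::real_normed_vector) \<Rightarrow> bool" where
  "linear_isometry U \<longleftrightarrow> linear U \<and> (\<forall>x. norm (U x) = norm x)"

lemma compatible_sip_self:
  assumes "compatible_sip s"
  shows "s x x = (norm x)\<^sup>2"
proof -
  have "sqrt (s x x) = norm x" using assms by (simp add: compatible_sip_def)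
  moreover have "s x x \<ge> 0"
    using calculation by (metis norm_ge_zero real_sqrt_ge_0_iff)
  ultimately show ?thesis by (metis real_sqrt_pow2)
qed

lemma compatible_sip_support:
  assumes s: "compatible_sip s" and y: "y \<noteq> 0"
  shows "\<exists>\<phi>. support_functional y \<phi> \<and> (\<forall>x. s x y = norm y * blinfun_apply \<phi> x)"
proof -
  have ny: "norm y > 0" using y by simp
  have bd: "\<bar>s x y\<bar> \<le> norm x * norm y" for x
    using s unfolding compatible_sip_def by metis
  have bl: "bounded_linear (\<lambda>x. s x y / norm y)"
  proof (rule bounded_linear_intro[where K=1])
    show "s (a + b) y / norm y = s a y / norm y + s b y / norm y" for a b
      using s by (simp add: compatible_sip_def add_divide_distrib)
    show "s (r *\<^sub>R a) y / norm y = r *\<^sub>R (s a y / norm y)" for r a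
      using s by (simp add: compatible_sip_def)
    show "norm (s a y / norm y) \<le> norm a * 1" for a
      using bd[of a] ny by (simp add: field_simps)
  qed
  define \<phi> where "\<phi> = Blinfun (\<lambda>x. s x y / norm y)"
  have ap: "blinfun_apply \<phi> x = s x y / norm y" for x
    using bl by (simp add: \<phi>_def bounded_linear_Blinfun_apply)
  have at: "blinfun_apply \<phi> y = norm y"
    using ny compatible_sip_self[OF s, of y] by (simp add: ap power2_eq_square)
  have "norm \<phi> \<le> 1"
    by (rule norm_blinfun_bound) (use bd ny in \<open>auto simp: ap field_simps\<close>)
  moreover have "norm y \<le> norm \<phi> * norm y"
    using norm_blinfun[of \<phi> y] at by simp
  ultimately have "norm \<phi> = 1" using ny by simp
  then show ?thesis
    using at ap ny by (intro exI[of _ \<phi>]) (simp add: support_functional_def)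
qed

lemma support_functional_scaleR:
  assumes "support_functional y \<phi>" "c \<noteq> 0"
  shows "support_functional (c *\<^sub>R y) (sgn c *\<^sub>R \<phi>)"
  using assms by (auto simp: support_functional_def blinfun.bilinear_simps sgn_if)

text \<open>On a smooth space the compatible semi-inner product is
  \<open>[x, y] = norm y * \<phi>\<^sub>y x\<close>, with \<open>\<phi>\<^sub>y\<close> the support functional at \<open>y \<noteq> 0\<close>.\<close>

lemma smooth_compatible_sip_iff:
  fixes s :: "'a::real_normed_vector \<Rightarrow> 'a \<Rightarrow> real"
  assumes sm: "smooth_space TYPE('a)"
  shows "compatible_sip s \<longleftrightarrow>
    s = (\<lambda>x y. if y = 0 then 0 else norm y * blinfun_apply (THE \<phi>. support_functional y \<phi>) x)"
    (is "_ \<longleftrightarrow> s = ?t")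
proof
  assume s: "compatible_sip s"
  show "s = ?t"
  proof (intro ext)
    fix x y :: 'a
    show "s x y = ?t x y"
    proof (cases "y = 0")
      case True
      have "s x (0 *\<^sub>R y) = 0 * s x y" using s unfolding compatible_sip_def by blast
      then show ?thesis using True by simp
    next
      case False
      then obtain \<phi> where "support_functional y \<phi>" "\<forall>x. s x y = norm y * blinfun_apply \<phi> x"
        using compatible_sip_support[OF s] by blast
      moreover have "(THE \<phi>. support_functional y \<phi>) = \<phi>"
        using sm False calculation(1) unfolding smooth_space_def by (blast intro: the1_equality)
      ultimately show ?thesis using False by simp
    qed
  qed
next
  assume st: "s = ?t"
  define P where "P y = (THE \<phi>. support_functional y \<phi>)" for y :: 'a
  have P: "support_functional y (P y)" if "y \<noteq> 0" for y
    using theI'[of "support_functional y"] sm that unfolding smooth_space_def P_def by blast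
  have Pc: "P (c *\<^sub>R y) = sgn c *\<^sub>R P y" if "y \<noteq> 0" "c \<noteq> 0" for c y
  proof -
    have "support_functional (c *\<^sub>R y) (sgn c *\<^sub>R P y)"
      using support_functional_scaleR[OF P] that by blast
    then show ?thesis
      using sm P[of "c *\<^sub>R y"] that unfolding smooth_space_def by (metis scaleR_eq_0_iff)
  qed
  have s: "s x y = (if y = 0 then 0 else norm y * blinfun_apply (P y) x)" for x y
    by (simp add: st P_def)
  have ss: "s x x = (norm x)\<^sup>2" for x
    using P[of x] by (simp add: s support_functional_def power2_eq_square)
  have bd: "\<bar>s x y\<bar> \<le> norm x * norm y" for x y
  proof (cases "y = 0")
    case False
    have "\<bar>blinfun_apply (P y) x\<bar> \<le> norm x"
      using norm_blinfun[of "P y" x] P[OF False] by (simp add: support_functional_def)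
    then show ?thesis using False by (simp add: s abs_mult mult.commute mult_left_mono)
  qed (simp add: s)
  have hom: "s x (c *\<^sub>R y) = c * s x y" for c x y
    by (cases "c = 0 \<or> y = 0")
      (auto simp: s Pc blinfun.bilinear_simps abs_mult_sgn sgn_if)
  show "compatible_sip s"
    unfolding compatible_sip_def
    using bd hom by (auto simp: ss) (auto simp: s blinfun.bilinear_simps algebra_simps)
qed

lemma smooth_ex1_compatible_sip:
  assumes "smooth_space TYPE('a::real_normed_vector)"
  shows "\<exists>!s::'a \<Rightarrow> 'a \<Rightarrow> real. compatible_sip s"
  by (simp add: smooth_compatible_sip_iff[OF assms])

end

(* Over a smooth space the semi-inner product [x, y] is the norm of y times the derivative at t = 0 of
   the norm of y + t x, so (iii) passes to (i) by differentiating, once strict convexity shows that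
   f maps t x to plus or minus t f x.  The substance is (i) ==> (ii).  A vector w outside the span
   of a finite set S minus its best approximation in span S is a vector z with [w, z] nonzero and
   [u, z] = 0 for every u in S.  Hence a surjective f satisfying (i) preserves and reflects
   membership in finite spans, and the same vectors z show that f (a x + b y) is a f x + b f y up
   to two signs.  Finally the signs are made coherent relative to one fixed nonzero vector. *)

theory Submission
  imports Defs
begin

section \<open>Algebra of the semi-inner product on a smooth space\<close>

lemma smooth_compatible_sip:
  assumes "smooth_space TYPE('a::real_normed_vector)"
  shows "compatible_sip (sip :: 'a \<Rightarrow> 'a \<Rightarrow> real)"
  using theI'[OF smooth_ex1_compatible_sip[OF assms]] by (simp add: sip_def)

context
  assumes sm: "smooth_space TYPE('a::real_normed_vector)"
begin

lemma sip_add_left: "sip (x + y) z = sip x z + sip y (z :: 'a)"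
  and sip_scaleR_left: "sip (c *\<^sub>R x) z = c * sip x (z :: 'a)"
  and sip_scaleR_right: "sip x (c *\<^sub>R z) = c * sip x (z :: 'a)"
  using smooth_compatible_sip[OF sm] by (auto simp: compatible_sip_def)

lemma sip_self: "sip x x = (norm (x :: 'a))\<^sup>2"
  using compatible_sip_self[OF smooth_compatible_sip[OF sm]] .

lemma abs_sip_le: "\<bar>sip x z\<bar> \<le> norm x * norm (z :: 'a)"
  using smooth_compatible_sip[OF sm] unfolding compatible_sip_def by metis

lemma sip_zero_left: "sip 0 (z :: 'a) = 0"
  using sip_scaleR_left[of 0 0 z] by simp

lemma sip_zero_right: "sip x (0 :: 'a) = 0"
  using sip_scaleR_right[of x 0 0] by simp

lemma sip_span_zero:
  assumes "u \<in> span S" "\<And>s. s \<in> S \<Longrightarrow> sip s (z :: 'a) = 0"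
  shows "sip u z = 0"
  using assms(1)
  by (induction rule: span_induct_alt) (auto simp: assms(2) sip_zero_left sip_add_left sip_scaleR_left)

end

section \<open>Smoothness and the derivative of the norm\<close>

text \<open>Tychonoff's theorem: the set is the product of the intervals from
  \<open>- norm v\<close> to \<open>norm v\<close>. It is the compactness behind Banach-Alaoglu,
  stated for arbitrary functions in the product topology; linearity of a cluster point is recovered
  later from pointwise limits.\<close>

lemma compact_functional_box:
  "compact {g :: 'a::real_normed_vector \<Rightarrow> real. \<forall>v. \<bar>g v\<bar> \<le> norm v}"
proof -
  have "{g :: 'a \<Rightarrow> real. \<forall>v. \<bar>g v\<bar> \<le> norm v} = PiE UNIV (\<lambda>v. {- norm v .. norm v})"
    by (auto simp: PiE_def Pi_def abs_le_iff minus_le_iff)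
  moreover have "compactin (product_topology (\<lambda>_. euclidean) UNIV)
      (PiE UNIV (\<lambda>v::'a. {- norm v .. norm v}))"
    by (subst compactin_PiE) auto
  ultimately show ?thesis
    by (simp add: euclidean_product_topology)
qed

text \<open>Norm-to-weak-star continuity of the duality map. It is what turns uniqueness of the
  support functional into differentiability of the norm.\<close>

lemma support_functional_tendsto:
  fixes y :: "'a::real_normed_vector"
  assumes sm: "smooth_space TYPE('a)" and y: "y \<noteq> 0" and \<phi>: "support_functional y \<phi>"
    and z: "(z \<longlongrightarrow> y) F" and \<psi>: "\<forall>\<^sub>F t in F. support_functional (z t) (\<psi> t)"
  shows "((\<lambda>t. blinfun_apply (\<psi> t) x) \<longlongrightarrow> blinfun_apply \<phi> x) F"
proof (rule ccontr)
  \<comment> \<open>A cluster point of the \<open>\<psi> t\<close> in the product topology is a support functional at \<open>y\<close>, so it is \<open>\<phi>\<close>.\<close>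
  assume "\<not> ?thesis"
  then obtain e where e: "e > 0" and ne: "\<not> (\<forall>\<^sub>F t in F. \<bar>\<psi> t x - \<phi> x\<bar> < e)"
    unfolding tendsto_iff dist_real_def by blast
  \<comment> \<open>If convergence failed, restricting to the parameters whose value at
    \<open>x\<close> is at least \<open>e\<close> away from \<open>\<phi> x\<close> would leave a
    proper filter. Every cluster point along it inherits the gap.\<close>
  define F' where "F' = inf F (principal {t. \<bar>\<psi> t x - \<phi> x\<bar> \<ge> e})"
  have F'F: "F' \<le> F" by (simp add: F'_def)
  have "F' \<noteq> bot"
    using ne unfolding F'_def trivial_limit_def eventually_inf_principal by (simp add: not_le)
  define G where "G = filtermap (\<lambda>t. blinfun_apply (\<psi> t)) F'"
  have "G \<noteq> bot" using \<open>F' \<noteq> bot\<close> by (simp add: G_def filtermap_bot_iff)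
  have \<psi>': "\<forall>\<^sub>F t in F'. support_functional (z t) (\<psi> t)" using \<psi> F'F by (rule filter_leD[rotated])
  have bd: "\<bar>\<xi> v\<bar> \<le> norm v" if "support_functional w \<xi>" for w v :: 'a and \<xi>
    using norm_blinfun[of \<xi> v] that by (simp add: support_functional_def)
  let ?K = "{g :: 'a \<Rightarrow> real. \<forall>v. \<bar>g v\<bar> \<le> norm v}"
  have "\<forall>\<^sub>F g in G. g \<in> ?K"
    unfolding G_def eventually_filtermap using \<psi>' by eventually_elim (auto intro: bd)
  then obtain g where g: "g \<in> ?K" and gG: "inf (nhds g) G \<noteq> bot"
    using compact_functional_box[unfolded compact_filter] \<open>G \<noteq> bot\<close> by blast
  \<comment> \<open>Along \<open>H\<close> the functionals converge pointwise to \<open>g\<close>,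
    and whatever holds eventually for the \<open>\<psi> t\<close> holds eventually along
    \<open>H\<close>; so linearity and the gap pass to \<open>g\<close>.\<close>
  define H where "H = inf (nhds g) G"
  have H: "H \<noteq> bot" "H \<le> nhds g" "H \<le> G" using gG by (auto simp: H_def)
  have HG: "eventually P H" if "\<forall>\<^sub>F t in F'. P (blinfun_apply (\<psi> t))" for P
    using that H(3) by (auto simp: G_def eventually_filtermap intro: filter_leD)
  have lim: "((\<lambda>h. h v) \<longlongrightarrow> g v) H" for v
  proof -
    have "((\<lambda>h. h v) \<longlongrightarrow> g v) (nhds g)"
    proof (rule topological_tendstoI)
      fix S :: "real set"
      assume S: "open S" "g v \<in> S"
      have "open ((\<lambda>h::'a \<Rightarrow> real. h v) -` S)"
        by (rule open_vimage[OF S(1) continuous_on_product_coordinates])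
      then show "\<forall>\<^sub>F h in nhds g. h v \<in> S"
        using S(2) unfolding eventually_nhds by blast
    qed
    then show ?thesis using H(2) by (rule tendsto_mono[rotated])
  qed
  have add: "g (a + b) = g a + g b" for a b
  proof (rule tendsto_unique[OF H(1) lim])
    have "\<forall>\<^sub>F h in H. h a + h b = h (a + b)" by (rule HG) (simp add: blinfun.add_right)
    then show "((\<lambda>h. h (a + b)) \<longlongrightarrow> g a + g b) H"
      by (rule Lim_transform_eventually[OF tendsto_add[OF lim lim]])
  qed
  have scale: "g (c *\<^sub>R a) = c * g a" for c a
  proof (rule tendsto_unique[OF H(1) lim])
    have "\<forall>\<^sub>F h in H. c * h a = h (c *\<^sub>R a)" by (rule HG) (simp add: blinfun.scaleR_right)
    then show "((\<lambda>h. h (c *\<^sub>R a)) \<longlongrightarrow> c * g a) H"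
      by (rule Lim_transform_eventually[OF tendsto_mult_left[OF lim]])
  qed
  have gy: "g y = norm y"
  proof (rule tendsto_unique[OF H(1) lim])
    \<comment> \<open>\<open>\<psi> t\<close> takes the value \<open>norm (z t)\<close> at
      \<open>z t\<close> and has norm 1, so its value at \<open>y\<close> differs from
      \<open>norm y\<close> by at most twice \<open>norm (z t - y)\<close>.\<close>
    have zF': "(z \<longlongrightarrow> y) F'" using z F'F by (rule tendsto_mono[rotated])
    have "((\<lambda>t. blinfun_apply (\<psi> t) y - norm y) \<longlongrightarrow> 0) F'"
    proof (rule Lim_null_comparison)
      show "\<forall>\<^sub>F t in F'. norm (\<psi> t y - norm y) \<le> 2 * norm (z t - y)"
        using \<psi>'
      proof eventually_elim
        case (elim t)
        have "\<psi> t y = norm (z t) - \<psi> t (z t - y)"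
          using elim by (simp add: blinfun.diff_right support_functional_def)
        then show ?case
          using bd[OF elim, of "z t - y"] norm_triangle_ineq3[of "z t" y] by auto
      qed
      show "((\<lambda>t. 2 * norm (z t - y)) \<longlongrightarrow> 0) F'"
        using tendsto_mult_right_zero[OF tendsto_norm_zero[OF LIM_zero[OF zF']]] .
    qed
    then have "((\<lambda>t. blinfun_apply (\<psi> t) y) \<longlongrightarrow> norm y) F'" by (rule LIM_zero_cancel)
    then have "((\<lambda>h. h y) \<longlongrightarrow> norm y) G" by (simp add: G_def filterlim_filtermap)
    then show "((\<lambda>h. h y) \<longlongrightarrow> norm y) H" using H(3) by (rule tendsto_mono[rotated])
  qed
  have "\<bar>g x - \<phi> x\<bar> \<ge> e"
  proof (rule tendsto_lowerbound[OF _ _ H(1)])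
    show "((\<lambda>h. \<bar>h x - \<phi> x\<bar>) \<longlongrightarrow> \<bar>g x - \<phi> x\<bar>) H" by (intro tendsto_intros lim)
    show "\<forall>\<^sub>F h in H. e \<le> \<bar>h x - \<phi> x\<bar>"
      by (rule HG) (simp add: F'_def eventually_inf_principal)
  qed
  have bl: "bounded_linear g"
    by (rule bounded_linear_intro[where K=1]) (use g in \<open>auto simp: add scale\<close>)
  have ap: "blinfun_apply (Blinfun g) = g" using bl by (rule bounded_linear_Blinfun_apply)
  have "norm (Blinfun g) \<le> 1"
    by (rule norm_blinfun_bound) (use g in \<open>auto simp: ap\<close>)
  moreover have "norm y \<le> norm (Blinfun g) * norm y"
    using norm_blinfun[of "Blinfun g" y] by (simp add: ap gy)
  ultimately have "support_functional y (Blinfun g)"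
    using y by (simp add: support_functional_def ap gy)
  then have "Blinfun g = \<phi>" using sm y \<phi> unfolding smooth_space_def by blast
  then have "g x = \<phi> x" using ap by auto
  then show False using \<open>\<bar>g x - \<phi> x\<bar> \<ge> e\<close> e by simp
qed

text \<open>Support functionals \<open>\<phi>\<close> at \<open>y\<close> and
  \<open>\<psi> t\<close> at \<open>y + t x\<close> squeeze the difference quotient: it lies between
  \<open>\<phi> x\<close> and \<open>\<psi> t x\<close>, in an order depending on the sign of
  \<open>t\<close>. As \<open>\<psi> t x\<close> tends to \<open>\<phi> x\<close>, the derivative is
  \<open>\<phi> x\<close>.\<close>

lemma norm_has_derivative_sip:
  fixes x y :: "'a::real_normed_vector"
  assumes sm: "smooth_space TYPE('a)" and y: "y \<noteq> 0"
  shows "((\<lambda>t. norm (y + t *\<^sub>R x)) has_real_derivative sip x y / norm y) (at 0)"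
proof -
  obtain \<phi> where \<phi>: "support_functional y \<phi>" and s: "\<And>v. sip v y = norm y * \<phi> v"
    using compatible_sip_support[OF smooth_compatible_sip[OF sm] y] by blast
  define z where "z t = y + t *\<^sub>R x" for t
  have z: "(z \<longlongrightarrow> y) (at 0)"
    unfolding z_def by (rule tendsto_eq_intros refl | simp)+
  \<comment> \<open>The choice is meaningful only where \<open>z t\<close> is nonzero, which holds
    for all \<open>t\<close> near 0.\<close>
  define \<psi> where "\<psi> t = (SOME \<psi>. support_functional (z t) \<psi>)" for t
  have \<psi>: "support_functional (z t) (\<psi> t)" if "z t \<noteq> 0" for t
    using that sm unfolding \<psi>_def smooth_space_def by (metis someI_ex)
  have nz: "\<forall>\<^sub>F t in at 0. z t \<noteq> 0"
    using z y by (rule tendsto_imp_eventually_ne)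
  then have \<psi>': "\<forall>\<^sub>F t in at 0. support_functional (z t) (\<psi> t)"
    by eventually_elim (rule \<psi>)
  have bd: "\<xi> v \<le> norm v" if "support_functional w \<xi>" for w v :: 'a and \<xi>
    using norm_blinfun[of \<xi> v] that by (simp add: support_functional_def)
  let ?q = "\<lambda>t. (norm (z t) - norm y) / t"
  have lim: "((\<lambda>t. \<psi> t x - \<phi> x) \<longlongrightarrow> 0) (at 0)"
    using support_functional_tendsto[OF sm y \<phi> z \<psi>'] by (rule LIM_zero)
  have "((\<lambda>t. ?q t - \<phi> x) \<longlongrightarrow> 0) (at 0)"
  proof (rule Lim_null_comparison)
    show "\<forall>\<^sub>F t in at 0. norm (?q t - \<phi> x) \<le> \<bar>\<psi> t x - \<phi> x\<bar>"
      using \<psi>' eventually_neq_at_within[of 0 0 UNIV]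
    proof eventually_elim
      case (elim t)
      have t: "t \<noteq> 0" by (fact elim(2))
      \<comment> \<open>Both estimates test a support functional at the other point:
        \<open>\<phi>\<close> at \<open>z t\<close>, then \<open>\<psi> t\<close> at
        \<open>y\<close>.\<close>
      have 1: "norm y + t * \<phi> x \<le> norm (z t)"
        using bd[OF \<phi>, of "z t"] \<phi> by (simp add: z_def blinfun.bilinear_simps support_functional_def)
      have 2: "norm (z t) - t * \<psi> t x \<le> norm y"
        using bd[OF elim(1), of y] elim(1)
        by (simp add: z_def blinfun.bilinear_simps support_functional_def)
      show ?case
      proof (cases "t > 0")
        case True
        then have "\<phi> x \<le> ?q t" "?q t \<le> \<psi> t x" using 1 2 by (simp_all add: field_simps)
        then show ?thesis by simp
      next
        case False
        then have "t < 0" using t by simp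
        then have "\<phi> x \<ge> ?q t" "?q t \<ge> \<psi> t x" using 1 2 by (simp_all add: field_simps)
        then show ?thesis by simp
      qed
    qed
    show "((\<lambda>t. \<bar>\<psi> t x - \<phi> x\<bar>) \<longlongrightarrow> 0) (at 0)" using lim by (rule tendsto_rabs_zero)
  qed
  then have "(?q \<longlongrightarrow> \<phi> x) (at 0)" by (rule LIM_zero_cancel)
  then show ?thesis
    using y by (simp add: has_field_derivative_iff z_def s)
qed

section \<open>Best approximation and separation from finite spans\<close>

text \<open>Induction on \<open>S\<close>. For a new \<open>a\<close> outside \<open>span S\<close>,
  the distance from \<open>w - t a\<close> to \<open>span S\<close> is continuous in
  \<open>t\<close> and unbounded as \<open>t\<close> grows in absolute value, so a best coefficient
  exists; the induction hypothesis supplies the rest of the approximant.\<close>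

lemma finite_span_best_approximation:
  fixes w :: "'a::real_normed_vector"
  assumes "finite S"
  shows "\<exists>u\<in>span S. \<forall>v\<in>span S. norm (w - u) \<le> norm (w - v)"
  using assms
proof (induction S arbitrary: w rule: finite_induct)
  case empty
  then show ?case by simp
next
  case (insert a S)
  show ?case
  proof (cases "a \<in> span S")
    case True
    then show ?thesis using insert.IH by (simp add: span_redundant)
  next
    case False
    let ?h = "\<lambda>w. infdist w (span S)"
    have ne: "span S \<noteq> {}" using span_zero by blast
    \<comment> \<open>The induction hypothesis makes the infimum attained. In particular distance
      zero means membership, which is why \<open>d\<close> below is positive.\<close>
    have att: "\<exists>u\<in>span S. ?h w = norm (w - u)" for w
    proof -
      obtain u where u: "u \<in> span S" "\<forall>v\<in>span S. norm (w - u) \<le> norm (w - v)"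
        using insert.IH by blast
      have "norm (w - u) \<le> ?h w"
        unfolding infdist_notempty[OF ne] by (rule cINF_greatest) (use ne u in \<open>auto simp: dist_norm\<close>)
      moreover have "?h w \<le> norm (w - u)" using infdist_le[OF u(1), of w] by (simp add: dist_norm)
      ultimately show ?thesis using u(1) by force
    qed
    obtain a0 where a0: "a0 \<in> span S" "?h a = norm (a - a0)" using att by blast
    define d where "d = ?h a"
    have d: "d > 0" using a0 False by (auto simp: d_def)
    \<comment> \<open>By homogeneity \<open>t a\<close> has distance at least
      \<open>\<bar>t\<bar> * d\<close> from \<open>span S\<close>, and a translation by
      \<open>w\<close> changes a distance by at most \<open>norm w\<close>.\<close>
    have low: "\<bar>t\<bar> * d - norm w \<le> ?h (w - t *\<^sub>R a)" for t
    proof (cases "t = 0")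
      case True
      then show ?thesis using infdist_nonneg[of w "span S"] norm_ge_zero[of w] by (simp del: norm_ge_zero)
    next
      case t: False
      obtain u where u: "u \<in> span S" "?h (w - t *\<^sub>R a) = norm (w - t *\<^sub>R a - u)" using att by blast
      have "d \<le> norm (a - (- (1 / t)) *\<^sub>R u)"
        using infdist_le[OF span_scale[OF u(1)], of a] by (metis d_def dist_norm)
      then have "\<bar>t\<bar> * d \<le> norm (t *\<^sub>R (a - (- (1 / t)) *\<^sub>R u))"
        by (simp add: mult_left_mono)
      also have "t *\<^sub>R (a - (- (1 / t)) *\<^sub>R u) = w - (w - t *\<^sub>R a - u)"
        using t by (simp add: algebra_simps)
      also have "norm \<dots> \<le> norm w + norm (w - t *\<^sub>R a - u)" by (rule norm_triangle_ineq4)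
      finally show ?thesis using u by simp
    qed
    \<comment> \<open>Outside the interval from \<open>-R\<close> to \<open>R\<close> the preceding
      lower bound is at least \<open>norm w\<close>, while the value at 0 is at most
      \<open>norm w\<close>; a minimum over the interval is therefore global.\<close>
    define R where "R = 2 * norm w / d"
    have R: "R \<ge> 0" using d by (simp add: R_def)
    have cont: "continuous_on {-R..R} (\<lambda>t. ?h (w - t *\<^sub>R a))"
      by (intro continuous_intros)
    obtain t where t: "t \<in> {-R..R}" "\<And>s. s \<in> {-R..R} \<Longrightarrow> ?h (w - t *\<^sub>R a) \<le> ?h (w - s *\<^sub>R a)"
      using continuous_attains_inf[OF _ _ cont] R by auto
    have min: "?h (w - t *\<^sub>R a) \<le> ?h (w - s *\<^sub>R a)" for s
    proof (cases "s \<in> {-R..R}")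
      case True
      then show ?thesis by (rule t)
    next
      case False
      then have "R * d \<le> \<bar>s\<bar> * d" using d by (intro mult_right_mono) auto
      then have "norm w \<le> ?h (w - s *\<^sub>R a)" using low[of s] d by (simp add: R_def)
      moreover have "?h (w - t *\<^sub>R a) \<le> ?h (w - 0 *\<^sub>R a)" using R by (intro t) auto
      moreover have "?h w \<le> norm w" using infdist_le[OF span_zero, of w S] by simp
      ultimately show ?thesis by simp
    qed
    obtain u where u: "u \<in> span S" "?h (w - t *\<^sub>R a) = norm (w - t *\<^sub>R a - u)" using att by blast
    show ?thesis
    proof (intro bexI[of _ "t *\<^sub>R a + u"] ballI)
      show "t *\<^sub>R a + u \<in> span (insert a S)"
        using u(1) by (meson insertI1 span_add span_base span_mono span_scale subsetD subset_insertI)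
      fix v assume "v \<in> span (insert a S)"
      then obtain s where s: "v - s *\<^sub>R a \<in> span S" by (auto simp: span_insert)
      have "norm (w - (t *\<^sub>R a + u)) \<le> ?h (w - s *\<^sub>R a)" using min[of s] u by (simp add: algebra_simps)
      also have "\<dots> \<le> norm (w - v)" using infdist_le[OF s, of "w - s *\<^sub>R a"] by (simp add: dist_norm)
      finally show "norm (w - (t *\<^sub>R a + u)) \<le> norm (w - v)" .
    qed
  qed
qed

text \<open>\<open>z\<close> is the residual of a best approximation of \<open>w\<close>. Moving it
  along \<open>span S\<close> cannot shorten it, so the derivative of the norm at \<open>z\<close>
  vanishes in these directions (Birkhoff-James orthogonality), and \<open>sip w z\<close> reduces to
  \<open>sip z z\<close>.\<close>

lemma sip_separates_span:
  fixes w :: "'a::real_normed_vector"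
  assumes sm: "smooth_space TYPE('a)" and S: "finite S" and w: "w \<notin> span S"
  obtains z where "sip w z \<noteq> 0" "\<And>u. u \<in> span S \<Longrightarrow> sip u z = 0"
proof -
  obtain w0 where w0: "w0 \<in> span S" "\<And>v. v \<in> span S \<Longrightarrow> norm (w - w0) \<le> norm (w - v)"
    using finite_span_best_approximation[OF S] by blast
  define z where "z = w - w0"
  have z: "z \<noteq> 0" using w w0(1) by (auto simp: z_def)
  have orth: "sip u z = 0" if u: "u \<in> span S" for u
  proof -
    have "norm (z + 0 *\<^sub>R u) \<le> norm (z + t *\<^sub>R u)" for t
      using w0(2)[OF span_diff[OF w0(1) span_scale[OF u, of t]]] by (simp add: z_def algebra_simps)
    then have "sip u z / norm z = 0"
      using DERIV_local_min[OF norm_has_derivative_sip[OF sm z], of 1] by simp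
    then show ?thesis using z by simp
  qed
  have "sip w z = sip z z + sip w0 z" by (simp add: z_def flip: sip_add_left[OF sm])
  then have "sip w z \<noteq> 0" using z orth[OF w0(1)] by (simp add: sip_self[OF sm])
  then show thesis using orth that by blast
qed

section \<open>Coherent choice of signs\<close>

text \<open>The Wigner-type argument, free of norms. Hypothesis \<open>span\<close> carries linear
  independence over to the images, so that coefficients can be compared. A nonzero \<open>x0\<close>
  serves as reference: the sign of \<open>U y\<close> is fixed by the values of \<open>f\<close> on
  the line through \<open>x0\<close> in direction \<open>y\<close>.\<close>

lemma linear_up_to_sign:
  fixes f :: "'a::real_vector \<Rightarrow> 'b::real_vector"
  assumes comb: "\<And>a b x y. \<exists>s t. \<bar>s\<bar> = 1 \<and> \<bar>t\<bar> = 1 \<and>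
      f (a *\<^sub>R x + b *\<^sub>R y) = (s * a) *\<^sub>R f x + (t * b) *\<^sub>R f y"
    and span: "\<And>w S. finite S \<Longrightarrow> f w \<in> span (f ` S) \<Longrightarrow> w \<in> span S"
  obtains U where "linear U" "\<And>x. \<exists>s. \<bar>s\<bar> = 1 \<and> f x = s *\<^sub>R U x"
proof (cases "\<exists>x::'a. x \<noteq> 0")
  case False
  have "f 0 = 0" using comb[of 0 0 0 0] by auto
  then have "f x = 0" for x using False by metis
  then have "linear f" by (intro linearI) simp_all
  then show thesis using that[of f] by (metis abs_one scaleR_one)
next
  case True
  then obtain x0 :: 'a where x0: "x0 \<noteq> 0" by blast
  define e where "e = f x0"
  define pm where "pm u v \<longleftrightarrow> (\<exists>s. \<bar>s\<bar> = 1 \<and> u = s *\<^sub>R v)" for u v :: 'b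
  have pmI: "pm (s *\<^sub>R v) v" if "\<bar>s\<bar> = 1" for s v using that by (auto simp: pm_def)
  have pm_scale: "pm (c *\<^sub>R u) (c *\<^sub>R v)" if "pm u v" for c u v
    using that by (auto simp: pm_def mult.commute)
  have pm_trans: "pm u w" if "pm u v" "pm v w" for u v w
    using that unfolding pm_def by (metis abs_mult mult_1 scaleR_scaleR)
  have scale: "pm (f (c *\<^sub>R x)) (c *\<^sub>R f x)" for c x
    using comb[of c x 0 0] by (auto simp: pm_def)
  have f_scale: "pm (f (c *\<^sub>R x)) (c *\<^sub>R v)" if "pm (f x) v" for c x v
    using pm_trans[OF scale pm_scale[OF that]] .
  have add: "\<exists>s t. \<bar>s\<bar> = 1 \<and> \<bar>t\<bar> = 1 \<and> f (x + y) = s *\<^sub>R u + t *\<^sub>R v"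
    if uv: "pm (f x) u" "pm (f y) v" for x y u v
  proof -
    obtain s t where "\<bar>s\<bar> = 1" "\<bar>t\<bar> = 1" "f (x + y) = s *\<^sub>R f x + t *\<^sub>R f y"
      using comb[of 1 x 1 y] by auto
    moreover obtain p q where "\<bar>p\<bar> = 1" "\<bar>q\<bar> = 1" "f x = p *\<^sub>R u" "f y = q *\<^sub>R v"
      using uv unfolding pm_def by blast
    ultimately show ?thesis
      by (intro exI[of _ "s * p"] exI[of _ "t * q"]) (simp add: abs_mult)
  qed
  have e: "e \<noteq> 0" using span[of "{}" x0] x0 by (auto simp: e_def)
  have span1: "u \<notin> span {e}" if "pm (f y) u" "y \<notin> span {x0}" for y u
  proof
    assume "u \<in> span {e}"
    then have "f y \<in> span (f ` {x0})" using that(1) by (auto simp: pm_def e_def span_scale)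
    then show False using span[of "{x0}" y] that(2) by simp
  qed
  have span2: "v \<notin> span {u, e}" if uv: "pm (f y) u" "pm (f z) v" "z \<notin> span {y, x0}" for y z u v
  proof
    assume v: "v \<in> span {u, e}"
    obtain s where s: "\<bar>s\<bar> = 1" "f y = s *\<^sub>R u" using uv(1) by (auto simp: pm_def)
    have "u = s *\<^sub>R f y" using s by (auto simp: abs_if split: if_splits)
    then have "{u, e} \<subseteq> span (f ` {y, x0})" by (auto simp: e_def span_base span_scale)
    then have "v \<in> span (f ` {y, x0})" using v by (meson span_minimal subspace_span subsetD)
    then have "f z \<in> span (f ` {y, x0})" using uv(2) by (auto simp: pm_def span_scale)
    then show False using span[of "{y, x0}" z] uv(3) by simp
  qed
  have coeff2: "a = a' \<and> b = b'"
    if u: "u \<notin> span {e}" and eq: "a *\<^sub>R e + b *\<^sub>R u = a' *\<^sub>R e + b' *\<^sub>R u" for a b a' b' u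
  proof -
    have *: "(b - b') *\<^sub>R u = (a' - a) *\<^sub>R e" using eq by (simp add: algebra_simps)
    have "b = b'"
    proof (rule ccontr)
      assume "b \<noteq> b'"
      then have "u = ((a' - a) / (b - b')) *\<^sub>R e"
        using arg_cong[OF *, of "scaleR (1 / (b - b'))"] by simp
      then show False using u by (auto simp: span_singleton)
    qed
    then show ?thesis using eq e by simp
  qed
  have coeff3: "a = a' \<and> b = b' \<and> c = c'"
    if u: "u \<notin> span {e}" and v: "v \<notin> span {u, e}"
      and eq: "a *\<^sub>R e + b *\<^sub>R u + c *\<^sub>R v = a' *\<^sub>R e + b' *\<^sub>R u + c' *\<^sub>R v" for a b c a' b' c' u v
  proof -
    have *: "(c - c') *\<^sub>R v = (a' - a) *\<^sub>R e + (b' - b) *\<^sub>R u" using eq by (simp add: algebra_simps)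
    have "c = c'"
    proof (rule ccontr)
      assume "c \<noteq> c'"
      then have "v = (1 / (c - c')) *\<^sub>R ((a' - a) *\<^sub>R e + (b' - b) *\<^sub>R u)"
        using arg_cong[OF *, of "scaleR (1 / (c - c'))"] by simp
      also have "\<dots> \<in> span {u, e}" by (intro span_scale span_add span_base) auto
      finally show False using v by simp
    qed
    then show ?thesis using coeff2[OF u] eq by simp
  qed
  \<comment> \<open>\<open>u\<close> is the sign choice of \<open>f y\<close> coherent with \<open>e = f x0\<close> along the whole line \<open>x0 + t y\<close>.\<close>
  define P where "P y u \<longleftrightarrow> pm (f y) u \<and> (\<forall>t. pm (f (x0 + t *\<^sub>R y)) (e + t *\<^sub>R u))" for y u
  \<comment> \<open>Two distinct candidates are opposite. At parameter 1 this makes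
    \<open>e + u\<close> equal to \<open>e - u\<close> up to sign, which forces \<open>u = 0\<close>
    or \<open>e = 0\<close>.\<close>
  have P_unique: "u = u'" if P: "P y u" "P y u'" for y u u'
  proof (rule ccontr)
    assume ne: "u \<noteq> u'"
    obtain a b where ab: "\<bar>a\<bar> = 1" "f y = a *\<^sub>R u" "\<bar>b\<bar> = 1" "f y = b *\<^sub>R u'"
      using P unfolding P_def pm_def by blast
    have "a \<noteq> b" using ab ne by auto
    then have "b = - a" using ab(1,3) by linarith
    then have "a *\<^sub>R u = a *\<^sub>R (- u')" using ab(2,4) by simp
    then have "u = - u'" unfolding scaleR_cancel_left using ab(1) by auto
    then have u': "u' = - u" by simp
    have "pm (f (x0 + 1 *\<^sub>R y)) (e + 1 *\<^sub>R u)" "pm (f (x0 + 1 *\<^sub>R y)) (e + 1 *\<^sub>R u')"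
      using P unfolding P_def by blast+
    then obtain p q where pq: "\<bar>p\<bar> = 1" "\<bar>q\<bar> = 1" "p *\<^sub>R (e + u) = q *\<^sub>R (e + u')"
      unfolding pm_def by auto
    then have eq: "(p - q) *\<^sub>R e + (p + q) *\<^sub>R u = 0" by (simp add: u' algebra_simps)
    consider "q = p" | "q = - p" using pq by linarith
    then show False
    proof cases
      case 1
      then have "u = 0" using eq pq(1) by auto
      then show False using u' ne by simp
    next
      case 2
      then show False using eq pq(1) e by auto
    qed
  qed
  have P_scale: "P (c *\<^sub>R y) (c *\<^sub>R u)" if "P y u" for c y u
    using that f_scale unfolding P_def by (metis scaleR_scaleR)
  \<comment> \<open>The point \<open>x0 + t (y + c x0)\<close> equals
    \<open>(1 + t c) x0 + t y\<close>. Extracting the factor \<open>1 + t c\<close> returns to the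
    line of \<open>y\<close>; where the factor vanishes only \<open>t y\<close> is left.\<close>
  have P_shift: "P (y + c *\<^sub>R x0) (u + c *\<^sub>R e)" if Py: "P y u" for c y u
    unfolding P_def
  proof (intro conjI allI)
    show "pm (f (y + c *\<^sub>R x0)) (u + c *\<^sub>R e)"
    proof (cases "c = 0")
      case False
      have "pm (f (c *\<^sub>R (x0 + (1 / c) *\<^sub>R y))) (c *\<^sub>R (e + (1 / c) *\<^sub>R u))"
        using Py f_scale unfolding P_def by blast
      then show ?thesis using False by (simp add: algebra_simps)
    qed (use Py in \<open>simp add: P_def\<close>)
    fix t
    show "pm (f (x0 + t *\<^sub>R (y + c *\<^sub>R x0))) (e + t *\<^sub>R (u + c *\<^sub>R e))"
    proof (cases "1 + t * c = 0")
      case True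
      have "x0 + t *\<^sub>R (y + c *\<^sub>R x0) = (1 + t * c) *\<^sub>R x0 + t *\<^sub>R y"
        "e + t *\<^sub>R (u + c *\<^sub>R e) = (1 + t * c) *\<^sub>R e + t *\<^sub>R u" by (simp_all add: algebra_simps)
      then show ?thesis using True Py f_scale unfolding P_def by simp
    next
      case False
      define d where "d = 1 + t * c"
      have dt: "d * (t / d) = t" using False by (simp add: d_def)
      have "x0 + t *\<^sub>R (y + c *\<^sub>R x0) = d *\<^sub>R (x0 + (t / d) *\<^sub>R y)"
        "e + t *\<^sub>R (u + c *\<^sub>R e) = d *\<^sub>R (e + (t / d) *\<^sub>R u)"
        unfolding scaleR_add_right scaleR_scaleR dt by (simp_all add: d_def algebra_simps)
      then show ?thesis using Py f_scale unfolding P_def by simp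
    qed
  qed
  have f0: "f 0 = 0" using comb[of 0 0 0 0] by auto
  have P0: "P 0 0" unfolding P_def by (auto simp: pm_def f0 e_def intro: exI[of _ 1])
  have P_ex: "\<exists>u. P y u" for y
  proof (cases "y \<in> span {x0}")
    case True
    then obtain c where "y = c *\<^sub>R x0" by (auto simp: span_singleton)
    then show ?thesis using P_shift[OF P0, of c] by auto
  next
    case False
    have "pm (f x0) e" by (auto simp: pm_def e_def intro: exI[of _ 1])
    \<comment> \<open>Extracting the sign in front of \<open>e\<close> leaves a single relative sign
      \<open>q\<close>, which may still depend on \<open>c\<close> and \<open>t\<close>.\<close>
    have line: "\<exists>p q. \<bar>p\<bar> = 1 \<and> \<bar>q\<bar> = 1 \<and> f (c *\<^sub>R x0 + t *\<^sub>R y) = p *\<^sub>R (c *\<^sub>R e + (t * q) *\<^sub>R v)"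
      if v: "pm (f y) v" for c t v
    proof -
      obtain p q where pq: "\<bar>p\<bar> = 1" "\<bar>q\<bar> = 1"
        "f (c *\<^sub>R x0 + t *\<^sub>R y) = p *\<^sub>R (c *\<^sub>R e) + q *\<^sub>R (t *\<^sub>R v)"
        using add[OF f_scale[OF \<open>pm (f x0) e\<close>] f_scale[OF v]] by blast
      have "p * p = 1" using pq(1) by (auto simp: abs_if split: if_splits)
      then have pqt: "p * (t * (p * q)) = q * t" by algebra
      then have "f (c *\<^sub>R x0 + t *\<^sub>R y) = p *\<^sub>R (c *\<^sub>R e + (t * (p * q)) *\<^sub>R v)"
        using pq(3) by (simp only: scaleR_add_right scaleR_scaleR pqt)
      moreover have "\<bar>p * q\<bar> = 1" using pq by (simp add: abs_mult)
      ultimately show ?thesis using pq(1) by blast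
    qed
    obtain p1 q1 where pq1: "\<bar>p1\<bar> = 1" "\<bar>q1\<bar> = 1" "f (x0 + y) = p1 *\<^sub>R (e + q1 *\<^sub>R f y)"
      using line[of "f y" 1 1] pmI[of 1 "f y"] by auto
    \<comment> \<open>The relative sign at parameter 1 defines the candidate; it remains to see that
      the same sign serves every \<open>t\<close>.\<close>
    define u where "u = q1 *\<^sub>R f y"
    have u: "pm (f y) u" unfolding u_def pm_def
      using pq1(2) by (intro exI[of _ q1]) (auto simp: abs_mult_self_eq simp flip: abs_mult_self_eq[of q1])
    have indep: "u \<notin> span {e}" using span1[OF u False] .
    have xy: "pm (f (x0 + y)) (e + u)" using pq1 by (auto simp: pm_def u_def)
    have "pm (f (x0 + t *\<^sub>R y)) (e + t *\<^sub>R u)" for t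
    proof -
      obtain p q where pq: "\<bar>p\<bar> = 1" "\<bar>q\<bar> = 1" "f (x0 + t *\<^sub>R y) = p *\<^sub>R (e + (t * q) *\<^sub>R u)"
        using line[OF u, of 1 t] by auto
      \<comment> \<open>Expanding \<open>f (2 x0 + (1 + t) y)\<close> both directly and through \<open>(x0 + y) + (x0 + t y)\<close>
        rules out a sign change between the parameters \<open>1\<close> and \<open>t\<close>.\<close>
      obtain p' q' where pq': "\<bar>p'\<bar> = 1" "\<bar>q'\<bar> = 1"
        "f (2 *\<^sub>R x0 + (1 + t) *\<^sub>R y) = p' *\<^sub>R (2 *\<^sub>R e + ((1 + t) * q') *\<^sub>R u)"
        using line[OF u, of 2 "1 + t"] by auto
      have "pm (f (x0 + t *\<^sub>R y)) (e + (t * q) *\<^sub>R u)" using pq by (auto simp: pm_def)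
      from add[OF xy this] obtain a b where ab: "\<bar>a\<bar> = 1" "\<bar>b\<bar> = 1"
        "f (x0 + y + (x0 + t *\<^sub>R y)) = a *\<^sub>R (e + u) + b *\<^sub>R (e + (t * q) *\<^sub>R u)" by blast
      have "x0 + y + (x0 + t *\<^sub>R y) = 2 *\<^sub>R x0 + (1 + t) *\<^sub>R y"
        by (simp add: algebra_simps scaleR_2)
      then have "p' *\<^sub>R (2 *\<^sub>R e + ((1 + t) * q') *\<^sub>R u) = a *\<^sub>R (e + u) + b *\<^sub>R (e + (t * q) *\<^sub>R u)"
        using pq'(3) ab(3) by metis
      then have "(2 * p') *\<^sub>R e + (p' * (1 + t) * q') *\<^sub>R u = (a + b) *\<^sub>R e + (a + b * t * q) *\<^sub>R u"
        by (simp add: algebra_simps)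
      from coeff2[OF indep this]
      have eq: "2 * p' = a + b" "p' * (1 + t) * q' = a + b * t * q" by auto
      \<comment> \<open>The sum of the two signs \<open>a\<close> and \<open>b\<close> is plus or
        minus 2, so they agree with each other and with \<open>p'\<close>.\<close>
      have "a = p'" "b = p'" using eq(1) pq'(1) ab(1,2) by linarith+
      then have "p' * ((1 + t) * q') = p' * (1 + t * q)" using eq(2) by (simp add: algebra_simps)
      then have "(1 + t) * q' = 1 + t * q" using pq'(1) by auto
      moreover have "q' = 1 \<or> q' = - 1" "q = 1 \<or> q = - 1" using pq(2) pq'(2) by linarith+
      \<comment> \<open>With \<open>q = -1\<close>, the value \<open>q' = -1\<close> is impossible
        and \<open>q' = 1\<close> forces \<open>t = 0\<close>, where the sign is immaterial.\<close>
      ultimately have "t * q = t" by auto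
      then show ?thesis using pq by (auto simp: pm_def)
    qed
    then show ?thesis using u unfolding P_def by blast
  qed
  define U where "U y = (THE u. P y u)" for y
  have PU: "P y (U y)" for y
    unfolding U_def using P_ex[of y] P_unique by (metis theI)
  have UI: "U y = u" if "P y u" for y u using PU that by (rule P_unique)
  have U_scale: "U (c *\<^sub>R y) = c *\<^sub>R U y" for c y by (rule UI[OF P_scale[OF PU]])
  have U_shift: "U (y + c *\<^sub>R x0) = U y + c *\<^sub>R e" for c y by (rule UI[OF P_shift[OF PU]])
  have U_x0: "U (c *\<^sub>R x0) = c *\<^sub>R e" for c using UI[OF P_shift[OF P0]] by simp
  have U_add: "U (y + z) = U y + U z" for y z
  proof -
    \<comment> \<open>The first two cases follow from the shift and scaling laws of
      \<open>U\<close>. In the third, \<open>e\<close>, \<open>U y\<close> and \<open>U z\<close>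
      are independent and coefficients can be compared.\<close>
    consider (y) c where "y = c *\<^sub>R x0" | (z) b c where "z = b *\<^sub>R y + c *\<^sub>R x0"
      | (indep) "y \<notin> span {x0}" "z \<notin> span {y, x0}"
    proof -
      have "\<exists>b c. z = b *\<^sub>R y + c *\<^sub>R x0" if "z \<in> span {y, x0}"
      proof -
        obtain b c where "z - b *\<^sub>R y = c *\<^sub>R x0"
          using \<open>z \<in> span {y, x0}\<close> by (auto simp: span_insert[of y] span_singleton)
        then have "z = b *\<^sub>R y + c *\<^sub>R x0" by (simp add: diff_eq_eq add.commute)
        then show ?thesis by blast
      qed
      then show thesis using that by (auto simp: span_singleton)
    qed
    then show ?thesis
    proof cases
      case y
      then show ?thesis using U_shift[of z c] U_x0[of c] by (simp add: add.commute)
    next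
      case z
      have "U (y + z) = U ((1 + b) *\<^sub>R y + c *\<^sub>R x0)" by (simp add: z algebra_simps)
      then show ?thesis unfolding z U_shift U_scale by (simp add: algebra_simps)
    next
      case indep
      have pm_U: "pm (f y) (U y)" "pm (f (x0 + y)) (e + U y)" for y
        using PU[of y] unfolding P_def by (blast, metis scaleR_one)
      have u: "U y \<notin> span {e}" using span1[OF pm_U(1) indep(1)] .
      have v: "U z \<notin> span {U y, e}" using span2[OF pm_U(1) pm_U(1) indep(2)] .
      obtain a b where ab: "\<bar>a\<bar> = 1" "\<bar>b\<bar> = 1" "U (y + z) = a *\<^sub>R U y + b *\<^sub>R U z"
      proof -
        obtain s t where st: "\<bar>s\<bar> = 1" "\<bar>t\<bar> = 1" "f (y + z) = s *\<^sub>R U y + t *\<^sub>R U z"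
          using add[OF pm_U(1) pm_U(1)] by blast
        obtain r where r: "\<bar>r\<bar> = 1" "f (y + z) = r *\<^sub>R U (y + z)"
          using pm_U(1) unfolding pm_def by blast
        have "U (y + z) = r *\<^sub>R f (y + z)" using r by (auto simp: abs_if split: if_splits)
        then show thesis using that[of "r * s" "r * t"] st r by (simp add: abs_mult scaleR_add_right)
      qed
      obtain s where s: "\<bar>s\<bar> = 1" "f (x0 + (y + z)) = s *\<^sub>R (e + U (y + z))"
        using pm_U(2) unfolding pm_def by blast
      \<comment> \<open>Grouping the sum as \<open>(x0 + y) + z\<close> ties the sign of
        \<open>U y\<close> to that of \<open>e\<close>; the grouping \<open>(x0 + z) + y\<close>
        does the same for \<open>U z\<close>. Hence \<open>a = 1\<close> and
        \<open>b = 1\<close>.\<close>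
      obtain p q where pq: "\<bar>p\<bar> = 1" "\<bar>q\<bar> = 1" "f ((x0 + y) + z) = p *\<^sub>R (e + U y) + q *\<^sub>R U z"
        using add[OF pm_U(2) pm_U(1)] by blast
      obtain p' q' where pq': "\<bar>p'\<bar> = 1" "\<bar>q'\<bar> = 1" "f ((x0 + z) + y) = p' *\<^sub>R (e + U z) + q' *\<^sub>R U y"
        using add[OF pm_U(2) pm_U(1)] by blast
      have "s *\<^sub>R e + (s * a) *\<^sub>R U y + (s * b) *\<^sub>R U z = p *\<^sub>R e + p *\<^sub>R U y + q *\<^sub>R U z"
        using trans[OF s(2)[symmetric] trans[OF arg_cong[of _ _ f] pq(3)]]
        by (simp add: ab(3) algebra_simps)
      from coeff3[OF u v this] have 1: "s = p" "s * a = p" by auto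
      have "s *\<^sub>R e + (s * a) *\<^sub>R U y + (s * b) *\<^sub>R U z = p' *\<^sub>R e + q' *\<^sub>R U y + p' *\<^sub>R U z"
        using trans[OF s(2)[symmetric] trans[OF arg_cong[of _ _ f] pq'(3)]]
        by (simp add: ab(3) algebra_simps)
      from coeff3[OF u v this] have 2: "s = p'" "s * b = p'" by auto
      have "s \<noteq> 0" using s(1) by auto
      then show ?thesis using 1 2 ab(3) by auto
    qed
  qed
  have "linear U" using U_add U_scale by (rule linearI)
  then show thesis using that PU unfolding P_def pm_def by blast
qed

section \<open>Maps preserving the semi-inner product up to sign\<close>

text \<open>Since \<open>f\<close> preserves and reflects vanishing of the semi-inner product, a
  separating vector on one side yields a contradiction on the other. A separating vector in the
  codomain must be written as a value of \<open>f\<close>, which is where surjectivity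
  enters.\<close>

lemma sip_preserving_span_iff:
  fixes f :: "'a::real_normed_vector \<Rightarrow> 'b::real_normed_vector"
  assumes smX: "smooth_space TYPE('a)" and smY: "smooth_space TYPE('b)" and "surj f"
    and sip: "\<And>x y. \<bar>sip (f x) (f y)\<bar> = \<bar>sip x y\<bar>" and S: "finite S"
  shows "f w \<in> span (f ` S) \<longleftrightarrow> w \<in> span S"
proof
  assume fw: "f w \<in> span (f ` S)"
  show "w \<in> span S"
  proof (rule ccontr)
    assume "w \<notin> span S"
    then obtain z where z: "sip w z \<noteq> 0" "\<And>u. u \<in> span S \<Longrightarrow> sip u z = 0"
      using sip_separates_span[OF smX S] by blast
    have "sip v (f z) = 0" if "v \<in> f ` S" for v
    proof -
      obtain s where s: "v = f s" "s \<in> S" using \<open>v \<in> f ` S\<close> by blast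
      then show ?thesis using z(2)[OF span_base[OF s(2)]] sip[of s z] by simp
    qed
    then have "sip (f w) (f z) = 0" by (rule sip_span_zero[OF smY fw])
    then show False using sip[of w z] z(1) by simp
  qed
next
  assume w: "w \<in> span S"
  show "f w \<in> span (f ` S)"
  proof (rule ccontr)
    assume "f w \<notin> span (f ` S)"
    then obtain z' where z': "sip (f w) z' \<noteq> 0" "\<And>u. u \<in> span (f ` S) \<Longrightarrow> sip u z' = 0"
      using sip_separates_span[OF smY finite_imageI[OF S]] by blast
    obtain z where z: "z' = f z" using \<open>surj f\<close> by (rule surjE)
    have "sip s z = 0" if "s \<in> S" for s
      using z'(2)[OF span_base[OF imageI[OF that]]] sip[of s z] by (simp add: z)
    then have "sip w z = 0" by (rule sip_span_zero[OF smX w])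
    then show False using sip[of w z] z'(1) by (simp add: z)
  qed
qed

lemma sip_preserving_norm:
  fixes f :: "'a::real_normed_vector \<Rightarrow> 'b::real_normed_vector"
  assumes smX: "smooth_space TYPE('a)" and smY: "smooth_space TYPE('b)"
    and sip: "\<And>x y. \<bar>sip (f x) (f y)\<bar> = \<bar>sip x y\<bar>"
  shows "norm (f x) = norm x"
  using sip[of x x] by (simp add: sip_self[OF smX] sip_self[OF smY])

text \<open>Span preservation for a singleton gives a factor \<open>k\<close>, and norm preservation
  gives \<open>\<bar>k\<bar> = \<bar>c\<bar>\<close>.\<close>

lemma sip_preserving_scaleR:
  fixes f :: "'a::real_normed_vector \<Rightarrow> 'b::real_normed_vector"
  assumes smX: "smooth_space TYPE('a)" and smY: "smooth_space TYPE('b)" and "surj f"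
    and sip: "\<And>x y. \<bar>sip (f x) (f y)\<bar> = \<bar>sip x y\<bar>"
  shows "\<exists>s. \<bar>s\<bar> = 1 \<and> f (c *\<^sub>R x) = (s * c) *\<^sub>R f x"
proof (cases "c = 0 \<or> x = 0")
  case True
  have "f 0 = 0" using sip_preserving_norm[OF smX smY sip, of 0] by simp
  then show ?thesis using True by (intro exI[of _ 1]) auto
next
  case False
  have "c *\<^sub>R x \<in> span {x}" by (simp add: span_base span_scale)
  then have "f (c *\<^sub>R x) \<in> span {f x}"
    using sip_preserving_span_iff[OF smX smY \<open>surj f\<close> sip, of "{x}"] by simp
  then obtain k where k: "f (c *\<^sub>R x) = k *\<^sub>R f x" by (auto simp: span_singleton)
  have "norm (f (c *\<^sub>R x)) = \<bar>k\<bar> * norm (f x)" unfolding k by (rule norm_scaleR)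
  then have "\<bar>c\<bar> * norm x = \<bar>k\<bar> * norm x" by (simp only: sip_preserving_norm[OF smX smY sip] norm_scaleR)
  then have "\<bar>k\<bar> = \<bar>c\<bar>" using False by (simp only: mult_cancel_right norm_eq_zero) auto
  then have "\<bar>k / c\<bar> = 1" using False by simp
  moreover have "f (c *\<^sub>R x) = (k / c * c) *\<^sub>R f x" unfolding k using False by simp
  ultimately show ?thesis by blast
qed

text \<open>Dependent vectors reduce to scaling. Otherwise span preservation gives coefficients
  \<open>a\<close> and \<open>b\<close>; pairing with a \<open>z\<close> such that
  \<open>sip y z = 0\<close> and \<open>sip x z \<noteq> 0\<close> isolates \<open>a\<close> and
  shows that it is a sign, and exchanging the roles of \<open>x\<close> and \<open>y\<close> treats
  \<open>b\<close>.\<close>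

lemma sip_preserving_add:
  fixes f :: "'a::real_normed_vector \<Rightarrow> 'b::real_normed_vector"
  assumes smX: "smooth_space TYPE('a)" and smY: "smooth_space TYPE('b)" and "surj f"
    and sip: "\<And>x y. \<bar>sip (f x) (f y)\<bar> = \<bar>sip x y\<bar>"
  shows "\<exists>s t. \<bar>s\<bar> = 1 \<and> \<bar>t\<bar> = 1 \<and> f (x + y) = s *\<^sub>R f x + t *\<^sub>R f y"
proof -
  note scale = sip_preserving_scaleR[OF smX smY \<open>surj f\<close> sip]
  have dep: "\<exists>s t. \<bar>s\<bar> = 1 \<and> \<bar>t\<bar> = 1 \<and> f (x + y) = s *\<^sub>R f x + t *\<^sub>R f y" if y: "y \<in> span {x}" for x y
  proof -
    obtain c where c: "y = c *\<^sub>R x" using y by (auto simp: span_singleton)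
    obtain s where s: "\<bar>s\<bar> = 1" "f ((1 + c) *\<^sub>R x) = (s * (1 + c)) *\<^sub>R f x" using scale by blast
    obtain t where t: "\<bar>t\<bar> = 1" "f (c *\<^sub>R x) = (t * c) *\<^sub>R f x" using scale by blast
    have "x + y = (1 + c) *\<^sub>R x" by (simp add: c algebra_simps)
    then have "f (x + y) = s *\<^sub>R f x + (s * c) *\<^sub>R f x" using s(2) by (simp add: algebra_simps)
    also have "t * t = 1" using t(1) by (metis abs_mult_self_eq mult_1)
    then have "(s * c) *\<^sub>R f x = (s * t) *\<^sub>R f y"
      unfolding c t(2) by (simp add: mult.assoc)
    finally have "f (x + y) = s *\<^sub>R f x + (s * t) *\<^sub>R f y" .
    moreover have "\<bar>s * t\<bar> = 1" using s t by (simp add: abs_mult)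
    ultimately show ?thesis using s(1) by blast
  qed
  consider "y \<in> span {x}" | "x \<in> span {y}" | "x \<notin> span {y}" "y \<notin> span {x}" by blast
  then show ?thesis
  proof cases
    case 1
    then show ?thesis by (rule dep)
  next
    case 2
    then obtain s t where "\<bar>s\<bar> = 1" "\<bar>t\<bar> = 1" "f (y + x) = s *\<^sub>R f y + t *\<^sub>R f x" using dep by blast
    then show ?thesis by (metis add.commute)
  next
    case 3
    have coeff: "\<bar>a\<bar> = 1"
      if x: "x \<notin> span {y}" and eq: "f (x + y) = a *\<^sub>R f x + b *\<^sub>R f y" for x y a b
    proof -
      obtain z where z: "sip x z \<noteq> 0" "\<And>u. u \<in> span {y} \<Longrightarrow> sip u z = 0"
        using sip_separates_span[OF smX _ x] by blast
      have y: "sip y z = 0" by (rule z(2)) (simp add: span_base)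
      then have "sip (f y) (f z) = 0" using sip[of y z] by simp
      then have "sip (f (x + y)) (f z) = a * sip (f x) (f z)"
        by (simp add: eq sip_add_left[OF smY] sip_scaleR_left[OF smY])
      then have "\<bar>sip x z\<bar> = \<bar>a\<bar> * \<bar>sip x z\<bar>"
        using sip[of "x + y" z] sip[of x z] y by (simp add: sip_add_left[OF smX] abs_mult)
      then show ?thesis using z(1) by simp
    qed
    have "x + y \<in> span {x, y}" by (intro span_add span_base) auto
    then have "f (x + y) \<in> span {f x, f y}"
      using sip_preserving_span_iff[OF smX smY \<open>surj f\<close> sip, of "{x, y}"] by simp
    then obtain a b where "f (x + y) - a *\<^sub>R f x = b *\<^sub>R f y"
      by (auto simp: span_insert[of "f x"] span_singleton)
    then have eq: "f (x + y) = a *\<^sub>R f x + b *\<^sub>R f y" by (simp add: diff_eq_eq add.commute)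
    moreover have "\<bar>a\<bar> = 1" using 3(1) eq by (rule coeff)
    moreover have "\<bar>b\<bar> = 1" using coeff[OF 3(2), of b a] eq by (simp add: add.commute)
    ultimately show ?thesis by blast
  qed
qed

lemma sip_preserving_imp_phase_isometry:
  fixes f :: "'a::real_normed_vector \<Rightarrow> 'b::real_normed_vector"
  assumes smX: "smooth_space TYPE('a)" and smY: "smooth_space TYPE('b)" and surj: "surj f"
    and sip: "\<And>x y. \<bar>sip (f x) (f y)\<bar> = \<bar>sip x y\<bar>"
  shows "\<exists>U. linear_isometry U \<and> surj U \<and> phase_equivalent f U"
proof -
  note scale = sip_preserving_scaleR[OF smX smY surj sip]
  note nrm = sip_preserving_norm[OF smX smY sip]
  have comb: "\<exists>s t. \<bar>s\<bar> = 1 \<and> \<bar>t\<bar> = 1 \<and>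
      f (a *\<^sub>R x + b *\<^sub>R y) = (s * a) *\<^sub>R f x + (t * b) *\<^sub>R f y" for a b x y
  proof -
    obtain s t where st: "\<bar>s\<bar> = 1" "\<bar>t\<bar> = 1"
      "f (a *\<^sub>R x + b *\<^sub>R y) = s *\<^sub>R f (a *\<^sub>R x) + t *\<^sub>R f (b *\<^sub>R y)"
      using sip_preserving_add[OF smX smY surj sip] by blast
    obtain p q where "\<bar>p\<bar> = 1" "f (a *\<^sub>R x) = (p * a) *\<^sub>R f x"
      "\<bar>q\<bar> = 1" "f (b *\<^sub>R y) = (q * b) *\<^sub>R f y"
      using scale[of a x] scale[of b y] by blast
    with st show ?thesis
      by (intro exI[of _ "s * p"] exI[of _ "t * q"]) (simp add: abs_mult mult.assoc)
  qed
  obtain U where U: "linear U" "\<And>x. \<exists>s. \<bar>s\<bar> = 1 \<and> f x = s *\<^sub>R U x"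
    using linear_up_to_sign[OF comb] sip_preserving_span_iff[OF smX smY surj sip] by blast
  obtain \<sigma> where \<sigma>: "\<And>x. \<bar>\<sigma> x\<bar> = 1" "\<And>x. f x = \<sigma> x *\<^sub>R U x" using U(2) by metis
  have "norm (U x) = norm x" for x
    using nrm[of x] \<sigma>(1)[of x] unfolding \<sigma>(2)[of x] by simp
  then have "linear_isometry U" using U(1) by (simp add: linear_isometry_def)
  moreover have "surj U"
  proof (rule surjI)
    fix y
    \<comment> \<open>Linearity of \<open>U\<close> moves the sign into the argument, turning a
      preimage under \<open>f\<close> into one under \<open>U\<close>.\<close>
    show "U (\<sigma> (inv f y) *\<^sub>R inv f y) = y"
      using surj_f_inv_f[OF surj, of y] \<sigma>(2)[of "inv f y"] by (simp add: linear_cmul[OF U(1)])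
  qed
  moreover have "phase_equivalent f U" using \<sigma> unfolding phase_equivalent_def by blast
  ultimately show ?thesis by blast
qed

section \<open>Invariance under phase isometries\<close>

text \<open>The form pulled back along \<open>U\<close> is again compatible with the norm of the
  domain, so uniqueness identifies it with \<open>sip\<close>.\<close>

lemma linear_isometry_sip:
  fixes U :: "'a::real_normed_vector \<Rightarrow> 'b::real_normed_vector"
  assumes smX: "smooth_space TYPE('a)" and smY: "smooth_space TYPE('b)" and U: "linear_isometry U"
  shows "sip (U x) (U y) = sip x y"
proof -
  have lin: "linear U" and nrm: "\<And>x. norm (U x) = norm x" using U by (auto simp: linear_isometry_def)
  have "compatible_sip (\<lambda>x y. sip (U x) (U y))"
    unfolding compatible_sip_def linear_add[OF lin] linear_cmul[OF lin]
    using abs_sip_le[OF smY, of "U _" "U _"]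
    by (auto simp: sip_add_left[OF smY] sip_scaleR_left[OF smY] sip_scaleR_right[OF smY] sip_self[OF smY] nrm)
  then have "sip = (\<lambda>x y. sip (U x) (U y))"
    using smooth_ex1_compatible_sip[OF smX] smooth_compatible_sip[OF smX] by blast
  then show ?thesis by metis
qed

lemma phase_isometry_imp_sip_preserving:
  fixes f :: "'a::real_normed_vector \<Rightarrow> 'b::real_normed_vector"
  assumes smX: "smooth_space TYPE('a)" and smY: "smooth_space TYPE('b)"
    and U: "linear_isometry U" and f: "phase_equivalent f U"
  shows "\<bar>sip (f x) (f y)\<bar> = \<bar>sip x y\<bar>"
proof -
  obtain \<sigma> where "\<And>x. \<bar>\<sigma> x\<bar> = 1" "\<And>x. f x = \<sigma> x *\<^sub>R U x"
    using f unfolding phase_equivalent_def by blast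
  then show ?thesis
    by (simp add: sip_scaleR_left[OF smY] sip_scaleR_right[OF smY] linear_isometry_sip[OF smX smY U] abs_mult)
qed

text \<open>Changing signs at most swaps the two norms, which is why an identity of unordered pairs
  ignores phases.\<close>

lemma norm_pair_signs:
  fixes a b :: "'a::real_normed_vector"
  assumes "\<bar>s\<bar> = 1" "\<bar>t\<bar> = 1"
  shows "{norm (s *\<^sub>R a + t *\<^sub>R b), norm (s *\<^sub>R a - t *\<^sub>R b)} = {norm (a + b), norm (a - b)}"
proof -
  have "s = 1 \<or> s = - 1" "t = 1 \<or> t = - 1" using assms by linarith+
  moreover have "norm (- a - b) = norm (a + b)" "norm (- a + b) = norm (a - b)"
    using norm_minus_cancel[of "a + b"] norm_minus_commute[of a b] by simp_all
  ultimately show ?thesis by (auto simp: insert_commute)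
qed

lemma phase_isometry_imp_norm_pairs:
  assumes U: "linear_isometry U" and f: "phase_equivalent f U"
  shows "{norm (f x + f y), norm (f x - f y)} = {norm (x + y), norm (x - y)}"
proof -
  have lin: "linear U" and nrm: "\<And>x. norm (U x) = norm x" using U by (auto simp: linear_isometry_def)
  obtain \<sigma> where \<sigma>: "\<And>x. \<bar>\<sigma> x\<bar> = 1" "\<And>x. f x = \<sigma> x *\<^sub>R U x"
    using f unfolding phase_equivalent_def by blast
  have "{norm (f x + f y), norm (f x - f y)} = {norm (U x + U y), norm (U x - U y)}"
    unfolding \<sigma>(2) by (rule norm_pair_signs) (rule \<sigma>(1))+
  also have "\<dots> = {norm (x + y), norm (x - y)}"
    by (simp add: nrm flip: linear_add[OF lin] linear_diff[OF lin])
  finally show ?thesis .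
qed

section \<open>Strict convexity and the identity of norm pairs\<close>

text \<open>The normalised vectors \<open>p\<close> and \<open>q\<close> have a convex combination
  with positive weights equal to \<open>(a + b) / (norm a + norm b)\<close>. This is a unit vector,
  hence extreme, so \<open>p = q\<close>. The form without division covers zero vectors too.\<close>

lemma strictly_convex_norm_add:
  fixes a b :: "'a::real_normed_vector"
  assumes sc: "strictly_convex_space TYPE('a)" and eq: "norm (a + b) = norm a + norm b"
  shows "norm a *\<^sub>R b = norm b *\<^sub>R a"
proof (cases "a = 0 \<or> b = 0")
  case False
  define p q where "p = a /\<^sub>R norm a" and "q = b /\<^sub>R norm b"
  define u where "u = norm b / (norm a + norm b)"
  have pos: "norm a > 0" "norm b > 0" using False by auto
  then have u: "0 < u" "u < 1" by (auto simp: u_def add_pos_pos)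
  have u1: "1 - u = norm a / (norm a + norm b)"
    using pos by (simp add: u_def field_simps add_nonneg_eq_0_iff)
  have "norm a / (norm a + norm b) * inverse (norm a) = inverse (norm a + norm b)"
    "norm b / (norm a + norm b) * inverse (norm b) = inverse (norm a + norm b)"
    using pos by (simp_all add: divide_inverse mult.assoc)
  then have conv: "(1 - u) *\<^sub>R p + u *\<^sub>R q = (a + b) /\<^sub>R (norm a + norm b)"
    unfolding u1 by (simp only: u_def p_def q_def scaleR_scaleR scaleR_add_right)
  have "norm ((1 - u) *\<^sub>R p + u *\<^sub>R q) = 1" unfolding conv norm_scaleR eq using pos by (simp add: add_nonneg_eq_0_iff)
  then have "((1 - u) *\<^sub>R p + u *\<^sub>R q) extreme_point_of cball 0 1"
    using sc unfolding strictly_convex_space_def by simp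
  moreover have "p \<in> cball 0 1" "q \<in> cball 0 1" using pos by (auto simp: p_def q_def)
  ultimately have "(1 - u) *\<^sub>R p + u *\<^sub>R q \<notin> open_segment p q" by (simp add: extreme_point_of_def)
  then have "p = q" using u by (auto simp: in_segment)
  then have "(norm a * norm b) *\<^sub>R p = (norm a * norm b) *\<^sub>R q" by simp
  then show ?thesis using pos by (simp add: p_def q_def field_simps)
qed auto

lemma norm_pairs_norm:
  assumes pairs: "\<And>x y. {norm (f x + f y), norm (f x - f y)} = {norm (x + y), norm (x - y)}"
  shows "norm (f x) = norm x"
proof -
  have "{2 * norm (f x), 0} = {2 * norm x, 0}"
    using pairs[of x x] by (simp flip: scaleR_2)
  then show ?thesis by (auto simp: doubleton_eq_iff)
qed

text \<open>The larger of the norms of \<open>x + c x\<close> and \<open>x - c x\<close> is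
  \<open>(1 + \<bar>c\<bar>) * norm x\<close>. It must occur among the norms for \<open>f x\<close>
  and \<open>f (c x)\<close>, giving equality in the triangle inequality; strict convexity of the
  codomain then makes these images parallel.\<close>

lemma norm_pairs_scaleR:
  fixes f :: "'a::real_normed_vector \<Rightarrow> 'b::real_normed_vector"
  assumes sc: "strictly_convex_space TYPE('b)"
    and pairs: "\<And>x y. {norm (f x + f y), norm (f x - f y)} = {norm (x + y), norm (x - y)}"
  shows "\<exists>s. \<bar>s\<bar> = 1 \<and> f (c *\<^sub>R x) = (s * c) *\<^sub>R f x"
proof -
  note nrm = norm_pairs_norm[OF pairs]
  show ?thesis
  proof (cases "c = 0 \<or> x = 0")
    case True
    then show ?thesis using nrm[of 0] by (intro exI[of _ 1]) auto
  next
    case False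
    have "norm (x + c *\<^sub>R x) = \<bar>1 + c\<bar> * norm x" "norm (x - c *\<^sub>R x) = \<bar>1 - c\<bar> * norm x"
      by (metis norm_scaleR scaleR_add_left scaleR_one, metis norm_scaleR scaleR_diff_left scaleR_one)
    moreover have "(1 + \<bar>c\<bar>) * norm x \<in> {\<bar>1 + c\<bar> * norm x, \<bar>1 - c\<bar> * norm x}" by (auto simp: abs_if)
    ultimately have "(1 + \<bar>c\<bar>) * norm x \<in> {norm (f x + f (c *\<^sub>R x)), norm (f x - f (c *\<^sub>R x))}"
      using pairs[of x "c *\<^sub>R x"] by simp
    then obtain s where s: "\<bar>s\<bar> = 1" "norm (f x + s *\<^sub>R f (c *\<^sub>R x)) = (1 + \<bar>c\<bar>) * norm x"
      by (metis (no_types, opaque_lifting) abs_minus_cancel abs_one diff_conv_add_uminus insertE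
          scaleR_minus1_left scaleR_one singletonD)
    have "norm (f x + s *\<^sub>R f (c *\<^sub>R x)) = norm (f x) + norm (s *\<^sub>R f (c *\<^sub>R x))"
      by (simp add: s nrm algebra_simps)
    from strictly_convex_norm_add[OF sc this]
    have "norm x *\<^sub>R (s *\<^sub>R f (c *\<^sub>R x)) = norm x *\<^sub>R (\<bar>c\<bar> *\<^sub>R f x)"
      by (simp add: s nrm mult.commute)
    then have eq: "s *\<^sub>R f (c *\<^sub>R x) = \<bar>c\<bar> *\<^sub>R f x"
      unfolding scaleR_cancel_left using False by simp
    have "s * s = 1" using s(1) by (metis abs_mult_self_eq mult_1)
    then have "f (c *\<^sub>R x) = s *\<^sub>R (s *\<^sub>R f (c *\<^sub>R x))" by simp
    also have "\<dots> = (s * sgn c * c) *\<^sub>R f x" by (simp add: eq abs_sgn mult.commute mult.left_commute)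
    finally show ?thesis using s(1) False by (intro exI[of _ "s * sgn c"]) (simp add: abs_mult)
  qed
qed

text \<open>An unordered pair of norms determines the absolute value of their difference, hence that
  of the symmetric difference quotient at \<open>y\<close> in direction \<open>x\<close>. Its limit
  is twice the absolute value of \<open>sip x y / norm y\<close>.\<close>

lemma norm_pairs_imp_sip_preserving:
  fixes f :: "'a::real_normed_vector \<Rightarrow> 'b::real_normed_vector"
  assumes smX: "smooth_space TYPE('a)" and smY: "smooth_space TYPE('b)"
    and sc: "strictly_convex_space TYPE('b)"
    and pairs: "\<And>x y. {norm (f x + f y), norm (f x - f y)} = {norm (x + y), norm (x - y)}"
  shows "\<bar>sip (f x) (f y)\<bar> = \<bar>sip x y\<bar>"
proof -
  note nrm = norm_pairs_norm[OF pairs]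
  show ?thesis
  proof (cases "y = 0")
    case True
    then show ?thesis using nrm[of 0] by (simp add: sip_zero_right[OF smX] sip_zero_right[OF smY])
  next
    case y: False
    then have fy: "f y \<noteq> 0" using nrm[of y] by auto
    \<comment> \<open>Stated over its own type variable, so that it serves both the domain and the
      codomain.\<close>
    have quot: "((\<lambda>t. \<bar>(norm (v + t *\<^sub>R u) - norm (v - t *\<^sub>R u)) / t\<bar>) \<longlongrightarrow> \<bar>2 * (sip u v / norm v)\<bar>) (at 0)"
      if sm: "smooth_space TYPE('c)" and v: "v \<noteq> 0" for u v :: "'c::real_normed_vector"
    proof -
      let ?g = "\<lambda>t. norm (v + t *\<^sub>R u)"
      have "(?g has_real_derivative sip u v / norm v) (at 0)"
        by (rule norm_has_derivative_sip[OF sm v])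
      moreover from this have "((\<lambda>t. ?g (- t)) has_real_derivative - (sip u v / norm v)) (at 0)"
        using DERIV_mirror[of ?g _ 0] by simp
      ultimately have "((\<lambda>t. ?g t - ?g (- t)) has_real_derivative
          sip u v / norm v - - (sip u v / norm v)) (at 0)"
        by (rule DERIV_diff)
      then have "((\<lambda>t. (?g t - ?g (- t)) / t) \<longlongrightarrow> 2 * (sip u v / norm v)) (at 0)"
        by (simp add: has_field_derivative_iff)
      then show ?thesis by (intro tendsto_rabs) simp
    qed
    \<comment> \<open>The pair identity concerns \<open>f (t x)\<close>, which equals
      \<open>t f x\<close> up to sign; the sign at most swaps the two norms, and the absolute value
      ignores a swap.\<close>
    have eq: "\<bar>(norm (f y + t *\<^sub>R f x) - norm (f y - t *\<^sub>R f x)) / t\<bar> =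
        \<bar>(norm (y + t *\<^sub>R x) - norm (y - t *\<^sub>R x)) / t\<bar>" for t
    proof -
      obtain s where s: "\<bar>s\<bar> = 1" "f (t *\<^sub>R x) = (s * t) *\<^sub>R f x"
        using norm_pairs_scaleR[OF sc pairs] by blast
      have "{norm (f y + t *\<^sub>R f x), norm (f y - t *\<^sub>R f x)} =
          {norm (f y + f (t *\<^sub>R x)), norm (f y - f (t *\<^sub>R x))}"
        using norm_pair_signs[of 1 s "f y" "t *\<^sub>R f x"] s by simp
      also have "\<dots> = {norm (y + t *\<^sub>R x), norm (y - t *\<^sub>R x)}" by (rule pairs)
      finally show ?thesis by (auto simp: doubleton_eq_iff abs_divide abs_minus_commute)
    qed
    have "\<bar>2 * (sip (f x) (f y) / norm (f y))\<bar> = \<bar>2 * (sip x y / norm y)\<bar>"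
      by (rule LIM_unique[OF quot[OF smY fy, of "f x", unfolded eq] quot[OF smX y, of x]])
    then show ?thesis using y by (simp add: nrm abs_mult abs_divide)
  qed
qed

theorem proposition2p3:
  fixes f :: "'a::real_normed_vector \<Rightarrow> 'b::real_normed_vector"
  assumes "smooth_space TYPE('a)"
    and "smooth_space TYPE('b)"
    and "strictly_convex_space TYPE('b)"
    and "surj f"
  shows "((\<forall>x y. \<bar>sip (f x) (f y)\<bar> = \<bar>sip x y\<bar>) \<longleftrightarrow>
          (\<exists>U. linear_isometry U \<and> surj U \<and> phase_equivalent f U))
       \<and> ((\<exists>U. linear_isometry U \<and> surj U \<and> phase_equivalent f U) \<longleftrightarrow>
          (\<forall>x y. {norm (f x + f y), norm (f x - f y)} = {norm (x + y), norm (x - y)}))"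
    (is "(?i \<longleftrightarrow> ?ii) \<and> (?ii \<longleftrightarrow> ?iii)")
proof -
  have "?i \<Longrightarrow> ?ii" using sip_preserving_imp_phase_isometry[OF assms(1,2,4)] by blast
  moreover have "?ii \<Longrightarrow> ?i" using phase_isometry_imp_sip_preserving[OF assms(1,2)] by blast
  moreover have "?ii \<Longrightarrow> ?iii" using phase_isometry_imp_norm_pairs by blast
  moreover have "?iii \<Longrightarrow> ?i" using norm_pairs_imp_sip_preserving[OF assms(1-3)] by blast
  ultimately show ?thesis by blast
qed

end
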